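(* For every integer $n \geq 5$, the complete symmetric digraph $K_n^*$ admits a $(\vec{C}_2, \vec{C}_{n-2})$-factorization.
   Context: $K_n^*$ denotes the complete symmetric digraph on $n$ vertices (for every ordered pair of distinct vertices $(u,v)$ there is exactly one arc from $u$ to $v$). $\vec{C}_m$ denotes a directed cycle of length $m$; in particular $\vec{C}_2$ on vertices $u,v$ consists of the two arcs $(u,v)$ and $(v,u)$. A directed 2-factor of a digraph $D$ is a spanning subdigraph that is a disjoint union of directed cycles. For $2\le m_1\le\dots\le m_t$ with $m_1+\dots+m_t=n$, a $(\vec{C}_{m_1},\ldots,\vec{C}_{m_t})$-factor of $D$ is a directed 2-factor consisting of $t$ pairwise vertex-disjoint directed cycles of lengths $m_1,\ldots,m_t$; a $(\vec{C}_{m_1},\ldots,\vec{C}_{m_t})$-factorization of $D$ is a partition of the arc set of $D$ into $(\vec{C}_{m_1},\ldots,\vec{C}_{m_t})$-factors. *)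

theory Defs
  imports "Graph_Theory.Graph_Theory" "HOL-Library.Disjoint_Sets"
begin

text \<open>
  The complete symmetric digraph on \<open>n\<close> vertices is the library's \<open>K\<^bsub>n\<^esub>\<close>
  (\<^const>\<open>complete_digraph\<close>): a finite digraph without loops and parallel arcs having
  an arc for every ordered pair of distinct vertices.
\<close>

text \<open>
  \<open>C\<close> is a directed cycle of length \<open>m\<close>. The library predicate \<^const>\<open>pre_digraph.cycle\<close>
  is about arc walks; here it is required that \<open>C\<close> consists of nothing but such a walk.
\<close>
definition directed_cycle :: "nat \<Rightarrow> ('a, 'b) pre_digraph \<Rightarrow> bool" where
  "directed_cycle m C \<longleftrightarrow> 2 \<le> m \<and>
     (\<exists>p. pre_digraph.cycle C p \<and> length p = m \<and> arcs C = set p \<and> verts C = head C ` set p)"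

text \<open>
  Subdigraphs in the library share the tail and head functions of the ambient digraph,
  so they are determined by their vertices and arcs.
\<close>
definition directed_cycle_factor ::
    "nat list \<Rightarrow> ('a, 'b) pre_digraph \<Rightarrow> ('a, 'b) pre_digraph \<Rightarrow> bool" where
  "directed_cycle_factor ms D F \<longleftrightarrow> spanning F D \<and>
     (\<exists>Cs. list_all2 directed_cycle ms Cs \<and>
        (\<forall>C \<in> set Cs. subgraph C F) \<and>
        disjoint_family_on (\<lambda>i. verts (Cs ! i)) {..<length Cs} \<and>
        verts F = (\<Union>C \<in> set Cs. verts C) \<and>
        arcs F = (\<Union>C \<in> set Cs. arcs C))"

definition has_directed_cycle_factorization ::
    "nat list \<Rightarrow> ('a, 'b) pre_digraph \<Rightarrow> bool" where
  "has_directed_cycle_factorization ms D \<longleftrightarrow>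
     (\<exists>P. partition_on (arcs D) P \<and>
        (\<forall>A \<in> P. \<exists>F. directed_cycle_factor ms D F \<and> arcs F = A))"

end

theory Submission
  imports Defs
begin

text \<open>
  Work in \<open>\<int>\<^sub>m\<close> with \<open>m = 2 * k + 1\<close>. A zigzag path \<open>A\<close> on \<open>{1..k}\<close> realises every absolute
  difference \<open>1, \<dots>, k - 1\<close>; following it by the reversal of its translate \<open>A + k\<close> realises both
  signs, and the connecting step has difference \<open>k\<close>. The resulting path on the nonzero residues
  realises every nonzero difference except \<open>-k\<close>, which is the difference of its closing arc.
  For even \<open>n\<close> take \<open>m = n - 1\<close>, close the path to a cycle, pair \<open>0\<close> with one extra vertex, and
  translate. For odd \<open>n\<close> take \<open>m = n - 2\<close>, close the path through a second extra vertex, and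
  translate; the arcs of difference \<open>-k\<close> form a Hamiltonian cycle of \<open>\<int>\<^sub>m\<close>, which is used together
  with the \<open>2\<close>-cycle on the two extra vertices. These \<open>n - 1\<close> factors cover all arcs, hence
  by counting they are arc-disjoint.
\<close>

section \<open>Consecutive pairs of lists\<close>

definition adj :: "'a list \<Rightarrow> ('a \<times> 'a) list" where
  "adj xs = zip xs (tl xs)"

definition cyc :: "'a list \<Rightarrow> ('a \<times> 'a) list" where
  "cyc xs = adj (xs @ [hd xs])"

lemma adj_simps [simp]:
  "adj [] = []" "adj [x] = []" "adj (x # y # zs) = (x, y) # adj (y # zs)"
  by (simp_all add: adj_def)

lemma adj_map: "adj (map f xs) = map (map_prod f f) (adj xs)"
  by (simp add: adj_def map_tl [symmetric] zip_map_map map_prod_def)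

lemma length_adj: "length (adj xs) = length xs - 1"
  by (simp add: adj_def)

lemma adj_append:
  assumes "xs \<noteq> []" "ys \<noteq> []"
  shows "adj (xs @ ys) = adj xs @ (last xs, hd ys) # adj ys"
  using assms
proof (induction xs rule: induct_list012)
  case (2 x)
  then show ?case by (cases ys) auto
qed auto

lemma set_adj_rev: "set (adj (rev xs)) = prod.swap ` set (adj xs)"
proof (induction xs rule: induct_list012)
  case (3 x y zs)
  then show ?case by (simp add: adj_append del: append_assoc)
qed auto

lemma length_cyc: "length (cyc xs) = length xs"
  by (simp add: cyc_def length_adj)

lemma cyc_eq: "xs \<noteq> [] \<Longrightarrow> cyc xs = adj xs @ [(last xs, hd xs)]"
  by (simp add: cyc_def adj_append)

lemma cyc_map: "xs \<noteq> [] \<Longrightarrow> cyc (map f xs) = map (map_prod f f) (cyc xs)"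
  by (simp add: cyc_def adj_map [symmetric] hd_map)

lemma cyc_pair [simp]: "cyc [x, y] = [(x, y), (y, x)]"
  by (simp add: cyc_def)

lemma adj_neq: "distinct xs \<Longrightarrow> (p, q) \<in> set (adj xs) \<Longrightarrow> p \<noteq> q"
  by (induction xs rule: induct_list012) (auto dest: set_zip_leftD simp: adj_def)

lemma adj_in_set: "(p, q) \<in> set (adj xs) \<Longrightarrow> p \<in> set xs \<and> q \<in> set xs"
  unfolding adj_def by (metis list.set_sel(2) set_zip_leftD set_zip_rightD tl_Nil)

lemma cyc_in_set: "(p, q) \<in> set (cyc xs) \<Longrightarrow> p \<in> set xs \<and> q \<in> set xs"
  by (cases "xs = []") (auto simp: cyc_eq dest: adj_in_set, simp_all add: cyc_def)

text \<open>The closing pair joins the last entry to the first; these are two different entries once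
  the list has length at least 2, whereas a singleton would give a loop.\<close>

lemma cyc_neq:
  assumes "distinct xs" "2 \<le> length xs" "(p, q) \<in> set (cyc xs)"
  shows "p \<noteq> q"
proof -
  obtain x y zs where "xs = x # y # zs"
    using assms(2) by (cases xs rule: remdups_adj.cases) auto
  then show ?thesis
    using assms adj_neq [of xs p q] by (auto simp: cyc_eq split: if_splits)
qed

section \<open>A path with prescribed differences\<close>

text \<open>This is the sequence 1, k, 2, k - 1, ... The recursion reflects \<open>{1..k}\<close>
  onto \<open>{2..k+1}\<close> and puts 1 in front, which treats both parities of k alike.\<close>

fun zigzag :: "nat \<Rightarrow> int list" where
  "zigzag 0 = []"
| "zigzag (Suc k) = 1 # map (\<lambda>x. int k + 2 - x) (zigzag k)"

lemma length_zigzag [simp]: "length (zigzag k) = k"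
  by (induction k) auto

lemma set_zigzag [simp]: "set (zigzag k) = {1..int k}"
  by (induction k) auto

text \<open>A reflection preserves absolute differences, so the tail inherits those of the shorter
  zigzag, and the new first step from 1 to \<open>k + 1\<close> adds the difference k.\<close>

lemma zigzag_difference:
  assumes "1 \<le> d" "d < int k"
  shows "\<exists>(p, q) \<in> set (adj (zigzag k)). \<bar>q - p\<bar> = d"
  using assms
proof (induction k)
  case (Suc k)
  then obtain j where j: "k = Suc j" by (cases k) auto
  let ?r = "\<lambda>x. int k + 2 - x"
  have *: "adj (zigzag (Suc k)) = (1, int k + 1) # map (map_prod ?r ?r) (adj (zigzag k))"
    by (simp add: j adj_map [symmetric])
  show ?case
  proof (cases "d = int k")
    case True
    then show ?thesis unfolding * by auto
  next
    case False
    then obtain p q where "(p, q) \<in> set (adj (zigzag k))" "\<bar>q - p\<bar> = d"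
      using Suc by auto
    then have "(?r p, ?r q) \<in> set (adj (zigzag (Suc k)))" "\<bar>?r q - ?r p\<bar> = d"
      unfolding * by (force, simp)
    then show ?thesis by blast
  qed
qed simp

definition dpath :: "nat \<Rightarrow> int list" where
  "dpath k = zigzag k @ rev (map (\<lambda>x. x + int k) (zigzag k))"

lemma length_dpath [simp]: "length (dpath k) = 2 * k"
  by (simp add: dpath_def)

lemma set_dpath [simp]: "set (dpath k) = {1..2 * int k}"
  by (auto simp: dpath_def image_add_atLeastAtMost')

text \<open>The zigzag starts with 1, so the path starts with 1 and its reversed translate ends with
  \<open>1 + k\<close>.\<close>

lemma dpath_closing:
  assumes "k \<ge> 1"
  shows "hd (dpath k) - last (dpath k) = - int k"
proof -
  obtain j where "k = Suc j" using assms by (cases k) auto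
  then show ?thesis by (simp add: dpath_def)
qed

lemma dpath_difference:
  assumes "d \<noteq> 0" "- int k < d" "d \<le> int k"
  shows "\<exists>(p, q) \<in> set (adj (dpath k)). q - p = d"
proof -
  let ?Z = "zigzag k" and ?f = "\<lambda>x. x + int k"
  have ne: "?Z \<noteq> []"
    using assms by (auto simp flip: length_0_conv)
  \<comment> \<open>Three kinds of steps: those of the zigzag, the connecting step from its last
    entry to the translate of that same entry, and the translated steps run backwards, whose
    differences have the opposite sign.\<close>
  have adj: "set (adj (dpath k)) = set (adj ?Z) \<union> {(last ?Z, last ?Z + int k)}
      \<union> prod.swap ` map_prod ?f ?f ` set (adj ?Z)"
    using ne by (simp add: dpath_def adj_append set_adj_rev adj_map hd_rev last_map)
  show ?thesis
  proof (cases "d = int k")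
    case True
    then show ?thesis unfolding adj by auto
  next
    case False
    then obtain p q where pq: "(p, q) \<in> set (adj ?Z)" "\<bar>q - p\<bar> = \<bar>d\<bar>"
      using zigzag_difference [of "\<bar>d\<bar>" k] assms by fastforce
    have "(p, q) \<in> set (adj (dpath k))" "(?f q, ?f p) \<in> set (adj (dpath k))"
      using pq(1) unfolding adj by force+
    moreover have "q - p = d \<or> ?f p - ?f q = d"
      using pq(2) by linarith
    ultimately show ?thesis by blast
  qed
qed

section \<open>Translates modulo an odd number\<close>

definition shift :: "int \<Rightarrow> int \<Rightarrow> int \<Rightarrow> int" where
  "shift m s x = (x + s) mod m"

lemma inj_on_shift: "inj_on (shift m s) {0..<m}"
proof
  fix x y assume "x \<in> {0..<m}" "y \<in> {0..<m}" "shift m s x = shift m s y"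
  then show "x = y"
    by (simp add: shift_def) (metis add_diff_cancel_right' mod_diff_left_eq mod_pos_pos_trivial)
qed

lemma shift_image: "0 < m \<Longrightarrow> shift m s ` {0..<m} = {0..<m}"
  by (rule endo_inj_surj) (auto simp: inj_on_shift shift_def)

text \<open>The path visits exactly the nonzero residues, and translation by s permutes all
  residues, so the one missed is the image s of 0.\<close>

lemma set_shift_dpath:
  assumes "s \<in> {0..<2 * int k + 1}"
  shows "set (map (shift (2 * int k + 1) s) (dpath k)) = {0..<2 * int k + 1} - {s}"
proof -
  let ?m = "2 * int k + 1"
  have "set (dpath k) = {0..<?m} - {0}" by auto
  then have "set (map (shift ?m s) (dpath k)) = shift ?m s ` {0..<?m} - shift ?m s ` {0}"
    unfolding set_map by (subst inj_on_image_set_diff [OF inj_on_shift, symmetric]) auto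
  also have "\<dots> = {0..<?m} - {s}"
    using assms by (subst shift_image) (auto simp: shift_def)
  finally show ?thesis .
qed

text \<open>By counting: the list has 2k entries and its set has 2k elements.\<close>

lemma distinct_shift_dpath:
  assumes "s \<in> {0..<2 * int k + 1}"
  shows "distinct (map (shift (2 * int k + 1) s) (dpath k))"
  by (rule card_distinct) (use assms in \<open>simp add: set_shift_dpath [OF assms] del: set_map\<close>)

text \<open>Translation by \<open>u - p\<close> takes p to u; it then takes q to v because the two
  pairs have the same difference modulo m.\<close>

lemma shift_to_pair:
  assumes "u \<in> {0..<m}" "v \<in> {0..<m}" "(q - p) mod m = (v - u) mod m"
  obtains s where "s \<in> {0..<m}" "shift m s p = u" "shift m s q = v"
proof
  show "(u - p) mod m \<in> {0..<m}" using assms(1) by auto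
  show "shift m ((u - p) mod m) p = u"
    using assms(1) by (simp add: shift_def mod_add_right_eq)
  have "(q - p + u) mod m = (v - u + u) mod m"
    using assms(3) by (metis mod_add_left_eq)
  then show "shift m ((u - p) mod m) q = v"
    using assms(2) by (simp add: shift_def mod_add_right_eq algebra_simps)
qed

lemma shift_dpath_cover:
  fixes k :: nat and u v :: int
  defines "m \<equiv> 2 * int k + 1"
  assumes "u \<in> {0..<m}" "v \<in> {0..<m}" "u \<noteq> v" "(v - u) mod m \<noteq> (- int k) mod m"
  obtains s where "s \<in> {0..<m}" "(u, v) \<in> set (adj (map (shift m s) (dpath k)))"
proof -
  \<comment> \<open>The representative of \<open>v - u\<close> modulo m of least absolute value; as
    \<open>v - u\<close> lies strictly between -m and m, one correction by m suffices.\<close>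
  define d where "d = (if v - u > int k then v - u - m else if v - u < - int k then v - u + m else v - u)"
  have dm: "d mod m = (v - u) mod m"
    by (simp add: d_def)
  then have "d \<noteq> - int k" using assms(5) by auto
  moreover have "d \<noteq> 0" "- int k \<le> d" "d \<le> int k"
    using assms(2-4) by (auto simp: d_def m_def)
  ultimately obtain p q where pq: "(p, q) \<in> set (adj (dpath k))" "q - p = d"
    using dpath_difference [of d k] by auto
  obtain s where s: "s \<in> {0..<m}" "shift m s p = u" "shift m s q = v"
    by (rule shift_to_pair [OF assms(2,3), of q p]) (use pq dm in auto)
  have "(u, v) \<in> set (adj (map (shift m s) (dpath k)))"
    unfolding adj_map using pq(1) s by force
  with s that show thesis by blast
qed

section \<open>The Hamiltonian cycle of constant difference -k\<close>

definition step_cycle :: "nat \<Rightarrow> int list" where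
  "step_cycle k = map (\<lambda>i. (- int k * i) mod (2 * int k + 1)) [0..2 * int k]"

text \<open>Since -2k is congruent to 1 modulo \<open>2k + 1\<close>, 2 is the inverse of -k, and
  the residue x stands at position 2x modulo \<open>2k + 1\<close>.\<close>

lemma step_cycle_index:
  assumes "x \<in> {0..<2 * int k + 1}"
  shows "(- int k * ((2 * x) mod (2 * int k + 1))) mod (2 * int k + 1) = x"
proof -
  have "(- int k * ((2 * x) mod (2 * int k + 1))) mod (2 * int k + 1)
      = (- int k * (2 * x)) mod (2 * int k + 1)"
    by (rule mod_mult_right_eq)
  also have "- int k * (2 * x) = x + (- x) * (2 * int k + 1)"
    by (simp add: algebra_simps)
  finally show ?thesis using assms by (simp only: mod_mult_self1) simp
qed

lemma length_step_cycle [simp]: "length (step_cycle k) = 2 * k + 1"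
  by (simp add: step_cycle_def)

lemma set_step_cycle: "set (step_cycle k) = {0..<2 * int k + 1}"
proof
  show "{0..<2 * int k + 1} \<subseteq> set (step_cycle k)"
  proof
    fix x assume x: "x \<in> {0..<2 * int k + 1}"
    have "(2 * x) mod (2 * int k + 1) \<in> {0..2 * int k}"
      using pos_mod_bound [of "2 * int k + 1" "2 * x"] by auto
    then show "x \<in> set (step_cycle k)"
      unfolding step_cycle_def set_map set_upto
      using step_cycle_index [OF x] by (metis (no_types, lifting) image_eqI)
  qed
  show "set (step_cycle k) \<subseteq> {0..<2 * int k + 1}"
    unfolding step_cycle_def set_map
    by (rule image_subsetI) (simp del: mult_minus_left zle_add1_eq_le)
qed

lemma distinct_step_cycle: "distinct (step_cycle k)"
  by (rule card_distinct) (simp add: set_step_cycle)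

lemma step_cycle_cover:
  fixes k :: nat and u v :: int
  defines "m \<equiv> 2 * int k + 1"
  assumes "u \<in> {0..<m}" "v \<in> {0..<m}" "(v - u) mod m = (- int k) mod m"
  shows "(u, v) \<in> set (cyc (step_cycle k))"
proof -
  let ?f = "\<lambda>i. (- int k * i) mod m"
  \<comment> \<open>Index m has the same value 0 as index 0, so running the index up to m turns the
    closing pair into an ordinary step.\<close>
  have cyc_eq_adj: "cyc (step_cycle k) = adj (map ?f [0..2 * int k + 1])"
  proof -
    have "map ?f [0..2 * int k + 1] = map ?f [0..2 * int k] @ [?f m]"
      by (subst upto_rec2) (auto simp: m_def)
    also have "?f m = hd (map ?f [0..2 * int k])"
      by (subst upto_rec1) auto
    finally show ?thesis
      by (simp add: cyc_def step_cycle_def m_def)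
  qed
  have adj_upto: "(i, i + 1) \<in> set (adj [a..b])" if "a \<le> i" "i < b" for a b i :: int
  proof -
    have "[a..b] = [a..i] @ [i + 1..b]"
      using that by (intro upto_split2) auto
    moreover have "last [a..i] = i" "hd [i + 1..b] = i + 1"
      using that by (subst upto_rec2 upto_rec1; simp)+
    ultimately show ?thesis using that by (simp add: adj_append)
  qed
  define i where "i = (2 * u) mod m"
  have fi: "?f i = u"
    using step_cycle_index assms unfolding i_def m_def by blast
  have i: "0 \<le> i" "i < m"
    unfolding i_def m_def by (rule pos_mod_sign pos_mod_bound; simp)+
  \<comment> \<open>Advancing the index by one adds -k, which is congruent to \<open>v - u\<close>;
    hence the successor of u is v.\<close>
  have "?f (i + 1) = (- int k * i + (- int k) mod m) mod m"
    by (subst mod_add_right_eq) (simp add: algebra_simps)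
  also have "\<dots> = (?f i + (v - u)) mod m"
    unfolding assms(4) [symmetric] by (subst mod_add_right_eq, subst mod_add_left_eq) (rule refl)
  also have "\<dots> = v" using assms(3) unfolding fi by simp
  finally have "(u, v) = map_prod ?f ?f (i, i + 1)" using fi by simp
  moreover have "(i, i + 1) \<in> set (adj [0..2 * int k + 1])"
    using i by (intro adj_upto) (auto simp: m_def)
  ultimately show ?thesis
    unfolding cyc_eq_adj adj_map set_map by (rule image_eqI)
qed

section \<open>Factors covering all pairs\<close>

text \<open>Only covering is established here, one pair at a time; disjointness of the factors comes
  from \<open>covering_factors_disjoint\<close>.\<close>

lemma factor_lists:
  fixes n :: nat
  assumes "n \<ge> 5"
  obtains X Y :: "nat \<Rightarrow> int list"
  where "\<And>i. i < n - 1 \<Longrightarrow> length (X i) = 2"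
    and "\<And>i. i < n - 1 \<Longrightarrow> length (Y i) = n - 2"
    and "\<And>i. i < n - 1 \<Longrightarrow> distinct (X i @ Y i)"
    and "\<And>i. i < n - 1 \<Longrightarrow> set (X i @ Y i) = {0..<int n}"
    and "\<And>u v. u \<in> {0..<int n} \<Longrightarrow> v \<in> {0..<int n} \<Longrightarrow> u \<noteq> v \<Longrightarrow>
          \<exists>i<n - 1. (u, v) \<in> set (cyc (X i) @ cyc (Y i))"
proof (cases "even n")
  case True
  then have "n = 2 * (n div 2 - 1) + 2" "n div 2 - 1 \<ge> 1"
    using assms by presburger+
  then obtain k where n: "n = 2 * k + 2" and k: "k \<ge> 1" by blast
  define m where "m = 2 * int k + 1"
  \<comment> \<open>The extra vertex is \<open>m = n - 1\<close>; its partner i is the residue that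
    the i-th translated path misses.\<close>
  define X where "X i = [m, int i]" for i :: nat
  define Y where "Y i = map (shift m (int i)) (dpath k)" for i :: nat
  show thesis
  proof (rule that [of X Y])
    fix i assume "i < n - 1"
    then have i: "int i \<in> {0..<m}" by (auto simp: n m_def)
    have sY: "set (Y i) = {0..<m} - {int i}" and dY: "distinct (Y i)"
      using set_shift_dpath [of "int i" k] distinct_shift_dpath [of "int i" k] i
      unfolding Y_def m_def by simp_all
    show "length (X i) = 2" "length (Y i) = n - 2"
      by (simp_all add: X_def Y_def n)
    show "distinct (X i @ Y i)"
      using i by (simp add: X_def sY dY)
    show "set (X i @ Y i) = {0..<int n}"
      using i by (auto simp: X_def sY n m_def)
  next
    fix u v assume uv: "u \<in> {0..<int n}" "v \<in> {0..<int n}" "u \<noteq> v"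
    have *: "\<exists>i<n - 1. (u, v) \<in> set (cyc (X i) @ cyc (Y i))"
      if "s \<in> {0..<m}" "(u, v) \<in> set (cyc (X (nat s)) @ cyc (Y (nat s)))" for s
      using that by (intro exI [of _ "nat s"]) (auto simp: n m_def)
    have ne: "dpath k \<noteq> []"
      using k by (simp flip: length_0_conv)
    consider "u = m" | "v = m" | "u \<in> {0..<m}" "v \<in> {0..<m}"
      using uv by (fastforce simp: n m_def)
    then show "\<exists>i<n - 1. (u, v) \<in> set (cyc (X i) @ cyc (Y i))"
    proof cases
      case 1
      then show ?thesis using uv by (intro * [of v]) (auto simp: X_def n m_def)
    next
      case 2
      then show ?thesis using uv by (intro * [of u]) (auto simp: X_def n m_def)
    next
      case 3
      show ?thesis
      proof (cases "(v - u) mod m = (- int k) mod m")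
        case True
        \<comment> \<open>The difference -k never occurs inside a path, but the closing arc has it,
          so a translate of that arc is the required pair.\<close>
        obtain s where s: "s \<in> {0..<m}" "shift m s (last (dpath k)) = u" "shift m s (hd (dpath k)) = v"
          by (rule shift_to_pair [OF 3, of "hd (dpath k)" "last (dpath k)"])
            (use True dpath_closing [OF k] in auto)
        then have "(u, v) \<in> set (cyc (Y (nat s)))"
          using ne by (simp add: Y_def cyc_eq last_map hd_map)
        then show ?thesis using s by (intro * [of s]) auto
      next
        case False
        then obtain s where "s \<in> {0..<m}" "(u, v) \<in> set (adj (map (shift m s) (dpath k)))"
          using shift_dpath_cover [of u k v] 3 uv unfolding m_def by metis
        then show ?thesis
          using ne by (intro * [of s]) (auto simp: Y_def cyc_eq)
      qed
    qed
  qed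
next
  case False
  then have "n = 2 * (n div 2 - 1) + 3" "n div 2 - 1 \<ge> 1"
    using assms by presburger+
  then obtain k where n: "n = 2 * k + 3" and k: "k \<ge> 1" by blast
  define m where "m = 2 * int k + 1"
  \<comment> \<open>The extra vertices are m and \<open>m + 1\<close>. Indices below m are
    translations; the remaining index, m itself, marks the exceptional factor.\<close>
  define X where "X i = (if int i = m then [m, m + 1] else [m, int i])" for i :: nat
  define Y where "Y i = (if int i = m then step_cycle k
    else (m + 1) # map (shift m (int i)) (dpath k))" for i :: nat
  show thesis
  proof (rule that [of X Y])
    fix i assume i: "i < n - 1"
    show "length (X i) = 2" "length (Y i) = n - 2"
      by (simp_all add: X_def Y_def n)
    have "distinct (X i @ Y i) \<and> set (X i @ Y i) = {0..<int n}"
    proof (cases "int i = m")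
      case True
      then show ?thesis
        by (auto simp: X_def Y_def set_step_cycle distinct_step_cycle n m_def)
    next
      case False
      with i have i: "int i \<in> {0..<m}" by (auto simp: n m_def)
      let ?Z = "map (shift m (int i)) (dpath k)"
      have Z: "set ?Z = {0..<m} - {int i}" "distinct ?Z"
        using set_shift_dpath [of "int i" k] distinct_shift_dpath [of "int i" k] i
        unfolding m_def by simp_all
      have XY: "X i @ Y i = m # int i # (m + 1) # ?Z"
        using False by (simp add: X_def Y_def)
      show ?thesis
        unfolding XY list.set(2) distinct.simps(2) Z(1) using i Z(2) by (auto simp: n m_def)
    qed
    then show "distinct (X i @ Y i)" "set (X i @ Y i) = {0..<int n}" by blast+
  next
    fix u v assume uv: "u \<in> {0..<int n}" "v \<in> {0..<int n}" "u \<noteq> v"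
    have *: "\<exists>i<n - 1. (u, v) \<in> set (cyc (X i) @ cyc (Y i))"
      if "s \<in> {0..m}" "(u, v) \<in> set (cyc (X (nat s)) @ cyc (Y (nat s)))" for s
      using that by (intro exI [of _ "nat s"]) (auto simp: n m_def)
    have ne: "dpath k \<noteq> []"
      using k by (simp flip: length_0_conv)
    \<comment> \<open>The detour through \<open>m + 1\<close> replaces the closing arc of difference
      -k, so a translated factor has no arc of that difference between residues.\<close>
    have cY: "set (cyc (Y (nat s))) = {(m + 1, shift m s (hd (dpath k)))}
        \<union> set (adj (map (shift m s) (dpath k))) \<union> {(shift m s (last (dpath k)), m + 1)}"
      if "s \<in> {0..<m}" for s
      using that ne adj_append [of "[m + 1]" "map (shift m s) (dpath k)"]
      by (auto simp: Y_def cyc_eq last_map hd_map)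
    \<comment> \<open>Applied to either end of the path, this supplies all arcs between
      \<open>m + 1\<close> and the residues.\<close>
    have reach: "\<exists>s\<in>{0..<m}. shift m s x = y" if "y \<in> {0..<m}" for x y
      by (rule shift_to_pair [OF that that, of x x]) auto
    have "u \<in> {0..<m} \<or> u = m \<or> u = m + 1" "v \<in> {0..<m} \<or> v = m \<or> v = m + 1"
      using uv by (auto simp: n m_def)
    then consider "u = m" "v \<in> {0..<m}" | "v = m" "u \<in> {0..<m}" | "{u, v} = {m, m + 1}"
      | "u = m + 1" "v \<in> {0..<m}" | "v = m + 1" "u \<in> {0..<m}" | "u \<in> {0..<m}" "v \<in> {0..<m}"
      using uv(3) by blast
    then show "\<exists>i<n - 1. (u, v) \<in> set (cyc (X i) @ cyc (Y i))"
    proof cases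
      case 1
      then show ?thesis using uv by (intro * [of v]) (auto simp: X_def)
    next
      case 2
      then show ?thesis using uv by (intro * [of u]) (auto simp: X_def)
    next
      case 3
      then show ?thesis by (intro * [of m]) (auto simp: X_def m_def doubleton_eq_iff)
    next
      case 4
      then obtain s where "s \<in> {0..<m}" "shift m s (hd (dpath k)) = v"
        using reach [of v "hd (dpath k)"] by auto
      then show ?thesis using 4 cY [of s] by (intro * [of s]) auto
    next
      case 5
      then obtain s where "s \<in> {0..<m}" "shift m s (last (dpath k)) = u"
        using reach [of u "last (dpath k)"] by auto
      then show ?thesis using 5 cY [of s] by (intro * [of s]) auto
    next
      case 6
      show ?thesis
      proof (cases "(v - u) mod m = (- int k) mod m")
        case True
        then have "(u, v) \<in> set (cyc (step_cycle k))"
          using step_cycle_cover [of u k v] 6 unfolding m_def by blast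
        then show ?thesis by (intro * [of m]) (auto simp: Y_def m_def)
      next
        case False
        then obtain s where "s \<in> {0..<m}" "(u, v) \<in> set (adj (map (shift m s) (dpath k)))"
          using shift_dpath_cover [of u k v] 6 uv unfolding m_def by metis
        then show ?thesis using cY [of s] by (intro * [of s]) auto
      qed
    qed
  qed
qed

text \<open>There are \<open>n - 1\<close> factors with n arcs each, and exactly
  \<open>n * (n - 1)\<close> ordered pairs to cover. A surjection between finite sets of equal size
  is injective, so no pair is covered twice.\<close>

lemma covering_factors_disjoint:
  fixes X Y :: "nat \<Rightarrow> 'a list"
  assumes "finite V" "card V = n"
    and dist: "\<And>i. i < n - 1 \<Longrightarrow> distinct (X i @ Y i)"
    and set: "\<And>i. i < n - 1 \<Longrightarrow> set (X i @ Y i) = V"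
    and len: "\<And>i. i < n - 1 \<Longrightarrow> 2 \<le> length (X i) \<and> 2 \<le> length (Y i)"
    and cover: "\<And>u v. u \<in> V \<Longrightarrow> v \<in> V \<Longrightarrow> u \<noteq> v \<Longrightarrow>
      \<exists>i<n - 1. (u, v) \<in> set (cyc (X i) @ cyc (Y i))"
    and "i < n - 1" "j < n - 1"
    and "a \<in> set (cyc (X i) @ cyc (Y i))" "a \<in> set (cyc (X j) @ cyc (Y j))"
  shows "i = j"
proof -
  \<comment> \<open>\<open>g (i, l)\<close> is the l-th arc of the i-th factor.\<close>
  define g where "g = (\<lambda>(i, l). (cyc (X i) @ cyc (Y i)) ! l)"
  let ?A = "{..<n - 1} \<times> {..<n}" and ?B = "SIGMA u:V. V - {u}"
  have length: "length (cyc (X i) @ cyc (Y i)) = n" if "i < n - 1" for i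
    using distinct_card [OF dist [OF that]] set [OF that] \<open>card V = n\<close> by (simp add: length_cyc)
  have in_B: "set (cyc (X i) @ cyc (Y i)) \<subseteq> ?B" if "i < n - 1" for i
    using dist [OF that] set [OF that] len [OF that]
    by (auto dest: cyc_in_set cyc_neq)
  have image: "g ` ?A = ?B"
  proof
    show "g ` ?A \<subseteq> ?B"
    proof (rule image_subsetI)
      fix x assume "x \<in> ?A"
      then obtain i l where il: "x = (i, l)" "i < n - 1" "l < n" by auto
      then have "g x \<in> set (cyc (X i) @ cyc (Y i))"
        using nth_mem [of l "cyc (X i) @ cyc (Y i)"] length [of i] by (simp add: g_def)
      then show "g x \<in> ?B" using in_B [OF il(2)] by blast
    qed
    show "?B \<subseteq> g ` ?A"
    proof
      fix b assume "b \<in> ?B"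
      then obtain i where i: "i < n - 1" "b \<in> set (cyc (X i) @ cyc (Y i))"
        using cover by blast
      then obtain l where "l < n" "g (i, l) = b"
        using length [OF i(1)] unfolding g_def in_set_conv_nth by auto
      then show "b \<in> g ` ?A" using i(1) by force
    qed
  qed
  have "card ?B = card ?A"
    using assms(1,2) by (simp add: card_SigmaI)
  then have inj: "inj_on g ?A"
    by (intro eq_card_imp_inj_on) (simp_all only: image, simp)
  obtain l l' where "l < n" "g (i, l) = a" "l' < n" "g (j, l') = a"
    using assms(9,10) length [OF assms(7)] length [OF assms(8)]
    unfolding g_def in_set_conv_nth by auto
  then have "(i, l) = (j, l')"
    using inj_onD [OF inj, of "(i, l)" "(j, l')"] assms(7,8) by simp
  then show ?thesis by simp
qed

section \<open>Cycles as subdigraphs\<close>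

text \<open>Here \<open>e\<close> selects an arc with given ends. Induction on the vertex list shows
  that the selected arcs form a walk through precisely these vertices.\<close>

lemma cas_map_adj:
  fixes D :: "('a, 'b) pre_digraph"
  assumes "xs \<noteq> []"
    and "\<And>p q. (p, q) \<in> set (adj xs) \<Longrightarrow> tail D (e (p, q)) = p \<and> head D (e (p, q)) = q"
  shows "pre_digraph.cas D (hd xs) (map e (adj xs)) (last xs)"
    and "pre_digraph.awalk_verts D (hd xs) (map e (adj xs)) = xs"
  using assms
  by (induction xs rule: induct_list012)
    (simp_all add: pre_digraph.cas.simps pre_digraph.awalk_verts.simps)

lemma directed_cycle_cyc:
  fixes C :: "('a, 'b) pre_digraph"
  assumes "distinct xs" "2 \<le> length xs"
    and ends: "\<And>p q. (p, q) \<in> set (cyc xs) \<Longrightarrow> tail C (e (p, q)) = p \<and> head C (e (p, q)) = q"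
    and C: "verts C = set xs" "arcs C = e ` set (cyc xs)"
  shows "directed_cycle (length xs) C"
proof -
  let ?ys = "xs @ [hd xs]" and ?p = "map e (cyc xs)"
  have ne: "xs \<noteq> []" using assms(2) by auto
  have "pre_digraph.cas C (hd ?ys) (map e (adj ?ys)) (last ?ys)"
    "pre_digraph.awalk_verts C (hd ?ys) (map e (adj ?ys)) = ?ys"
    using ends by (intro cas_map_adj; simp add: cyc_def)+
  then have walk: "pre_digraph.cas C (hd xs) ?p (hd xs)"
    "pre_digraph.awalk_verts C (hd xs) ?p = ?ys"
    using ne by (simp_all add: cyc_def)
  \<comment> \<open>The library's cycles have distinct walk vertices after the first; here these are
    \<open>xs\<close> rotated by one place.\<close>
  have "distinct (tl ?ys)"
    using assms(1) by (cases xs) auto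
  moreover have "?p \<noteq> []"
    using ne by (simp add: cyc_eq)
  ultimately have cycle: "pre_digraph.cycle C ?p"
    unfolding pre_digraph.cycle_def pre_digraph.awalk_def
    using walk ne C by (intro exI [of _ "hd xs"]) auto
  have "(\<lambda>a. head C (e a)) ` set (cyc xs) = snd ` set (cyc xs)"
    using ends by (intro image_cong) auto
  also have "\<dots> = set (map snd (cyc xs))" by simp
  also have "map snd (cyc xs) = tl ?ys"
    by (simp add: cyc_def adj_def map_snd_zip_take)
  also have "set (tl ?ys) = set xs"
    using ne by (cases xs) auto
  finally have "verts C = head C ` set ?p"
    by (simp add: C image_image)
  then show ?thesis
    unfolding directed_cycle_def
    using assms(2) cycle C by (intro conjI exI [of _ ?p]) (auto simp: length_cyc)
qed

section \<open>Transfer from integer lists to the arcs of \<open>D\<close>\<close>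

theorem theorem3p4:
  fixes n :: nat and D :: "('a, 'b) pre_digraph"
  assumes "n \<ge> 5" and "complete_digraph n D"
  shows "has_directed_cycle_factorization [2, n - 2] D"
proof -
  interpret graph D using assms(2) by (simp add: complete_digraph_def)
  have card: "card (verts D) = n"
    and ends: "arcs_ends D = {(u, v). (u, v) \<in> verts D \<times> verts D \<and> u \<noteq> v}"
    using assms(2) by (simp_all add: complete_digraph_def)
  \<comment> \<open>The arc with given ends: it exists by completeness and is unique because
    \<open>D\<close> has no parallel arcs.\<close>
  define e where "e = inv_into (arcs D) (arc_to_ends D)"
  have e: "e (u, v) \<in> arcs D" "tail D (e (u, v)) = u" "head D (e (u, v)) = v"
    if "u \<in> verts D" "v \<in> verts D" "u \<noteq> v" for u v
  proof -
    have "(u, v) \<in> arc_to_ends D ` arcs D"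
      using that ends by (auto simp: arcs_ends_def)
    then show "e (u, v) \<in> arcs D" "tail D (e (u, v)) = u" "head D (e (u, v)) = v"
      using inv_into_into [of "(u, v)" "arc_to_ends D" "arcs D"]
        f_inv_into_f [of "(u, v)" "arc_to_ends D" "arcs D"]
      by (simp_all add: e_def arc_to_ends_def)
  qed
  have e_ends: "e (tail D a, head D a) = a" if "a \<in> arcs D" for a
    using that e [of "tail D a" "head D a"] no_loops [OF that]
    by (intro no_multi_arcs) (auto simp: arc_to_ends_def)
  obtain X0 Y0 :: "nat \<Rightarrow> int list"
    where XY0: "\<And>i. i < n - 1 \<Longrightarrow> length (X0 i) = 2"
      "\<And>i. i < n - 1 \<Longrightarrow> length (Y0 i) = n - 2"
      "\<And>i. i < n - 1 \<Longrightarrow> distinct (X0 i @ Y0 i)"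
      "\<And>i. i < n - 1 \<Longrightarrow> set (X0 i @ Y0 i) = {0..<int n}"
    and cover0: "\<And>u v. u \<in> {0..<int n} \<Longrightarrow> v \<in> {0..<int n} \<Longrightarrow> u \<noteq> v \<Longrightarrow>
      \<exists>i<n - 1. (u, v) \<in> set (cyc (X0 i) @ cyc (Y0 i))"
    by (rule factor_lists [OF assms(1)]) (rule that)
  obtain b where b: "bij_betw b {0..<int n} (verts D)"
    using finite_same_card_bij [of "{0..<int n}" "verts D"] card by auto
  define X where "X i = map b (X0 i)" for i
  define Y where "Y i = map b (Y0 i)" for i
  define A where "A i = set (cyc (X i) @ cyc (Y i))" for i
  have len: "length (X i) = 2" "length (Y i) = n - 2" if "i < n - 1" for i
    using XY0 that by (simp_all add: X_def Y_def)
  have ge2: "2 \<le> length (X i) \<and> 2 \<le> length (Y i)" if "i < n - 1" for i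
    using len [OF that] assms(1) by simp
  have dist: "distinct (X i @ Y i)" and set: "set (X i @ Y i) = verts D" if "i < n - 1" for i
  proof -
    have map: "X i @ Y i = map b (X0 i @ Y0 i)" by (simp add: X_def Y_def)
    show "distinct (X i @ Y i)" "set (X i @ Y i) = verts D"
      unfolding map distinct_map set_map XY0(4) [OF that]
      using b XY0(3) [OF that] by (auto simp: bij_betw_def)
  qed
  have cover: "\<exists>i<n - 1. (u, v) \<in> A i" if uv: "u \<in> verts D" "v \<in> verts D" "u \<noteq> v" for u v
  proof -
    obtain x y where xy: "x \<in> {0..<int n}" "y \<in> {0..<int n}" "u = b x" "v = b y"
      using uv b by (metis bij_betw_imp_surj_on imageE)
    then obtain i where i: "i < n - 1" "(x, y) \<in> set (cyc (X0 i) @ cyc (Y0 i))"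
      using cover0 [of x y] uv by auto
    have "X0 i \<noteq> []" "Y0 i \<noteq> []"
      using ge2 [OF i(1)] by (auto simp: X_def Y_def)
    then have "(u, v) \<in> A i"
      using i(2) xy by (force simp: A_def X_def Y_def cyc_map)
    with i show ?thesis by blast
  qed
  have A: "u \<in> verts D" "v \<in> verts D" "u \<noteq> v" if "i < n - 1" "(u, v) \<in> A i" for i u v
    using that(2) set [OF that(1)] dist [OF that(1)] ge2 [OF that(1)]
    by (auto simp: A_def dest: cyc_in_set cyc_neq)
  have disj: "i = j" if "i < n - 1" "j < n - 1" "a \<in> A i" "a \<in> A j" for i j a
    using covering_factors_disjoint [OF finite_verts card, of X Y i j a] dist set ge2 cover that
    unfolding A_def by blast
  \<comment> \<open>Taking ends is a left inverse of \<open>e\<close> on these pairs, so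
    disjointness of the sets \<open>A i\<close> passes to sets of arcs.\<close>
  have e_inj: "inj_on e (\<Union>i<n - 1. A i)"
    by (rule inj_on_inverseI [where g = "arc_to_ends D"]) (auto simp: arc_to_ends_def A e)
  have "partition_on (arcs D) ((\<lambda>i. e ` A i) ` {..<n - 1})"
  proof (rule partition_onI)
    show "\<Union> ((\<lambda>i. e ` A i) ` {..<n - 1}) = arcs D"
    proof
      show "\<Union> ((\<lambda>i. e ` A i) ` {..<n - 1}) \<subseteq> arcs D"
        using A e(1) by fastforce
      show "arcs D \<subseteq> \<Union> ((\<lambda>i. e ` A i) ` {..<n - 1})"
      proof
        fix a assume a: "a \<in> arcs D"
        then obtain i where "i < n - 1" "(tail D a, head D a) \<in> A i"
          using cover [of "tail D a" "head D a"] no_loops [OF a] by auto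
        then show "a \<in> \<Union> ((\<lambda>i. e ` A i) ` {..<n - 1})"
          using e_ends [OF a] by (metis UN_I image_eqI lessThan_iff)
      qed
    qed
  next
    fix p q assume "p \<in> (\<lambda>i. e ` A i) ` {..<n - 1}" "q \<in> (\<lambda>i. e ` A i) ` {..<n - 1}" "p \<noteq> q"
    then obtain i j where ij: "i < n - 1" "j < n - 1" "p = e ` A i" "q = e ` A j" "i \<noteq> j"
      by auto
    then have "A i \<inter> A j = {}" using disj by blast
    moreover have "e ` (A i \<inter> A j) = e ` A i \<inter> e ` A j"
      using ij by (intro inj_on_image_Int [OF e_inj]) auto
    ultimately show "disjnt p q" by (simp add: disjnt_def ij)
  next
    \<comment> \<open>Blocks of a partition must be nonempty; the 2-cycle already supplies
      arcs.\<close>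
    have "A i \<noteq> {}" if "i < n - 1" for i
    proof -
      have "X i \<noteq> []" using ge2 [OF that] by auto
      then show ?thesis by (simp add: A_def cyc_eq)
    qed
    then show "{} \<notin> (\<lambda>i. e ` A i) ` {..<n - 1}" by auto
  qed
  moreover have "\<exists>F. directed_cycle_factor [2, n - 2] D F \<and> arcs F = e ` A i" if i: "i < n - 1" for i
  proof -
    define C where "C xs = \<lparr>verts = set xs, arcs = e ` set (cyc xs), tail = tail D, head = head D\<rparr>" for xs
    define F where "F = \<lparr>verts = verts D, arcs = e ` A i, tail = tail D, head = head D\<rparr>"
    have sub_A: "set (cyc (X i)) \<subseteq> A i" "set (cyc (Y i)) \<subseteq> A i"
      by (auto simp: A_def)
    have ends_C: "tail D (e (p, q)) = p \<and> head D (e (p, q)) = q"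
      if "(p, q) \<in> A i" for p q
      using A [OF i that] e by blast
    have "directed_cycle (length xs) (C xs)"
      if "distinct xs" "2 \<le> length xs" "set (cyc xs) \<subseteq> A i" for xs
      using that ends_C by (intro directed_cycle_cyc [where e = e]) (auto simp: C_def)
    from this [of "X i"] this [of "Y i"]
    have cycles: "list_all2 directed_cycle [2, n - 2] [C (X i), C (Y i)]"
      using dist [OF i] ge2 [OF i] sub_A len [OF i] by simp
    have wf_F: "wf_digraph F"
      by unfold_locales (use A [OF i] e in \<open>auto simp: F_def\<close>)
    have "wf_digraph (C xs)" if "set (cyc xs) \<subseteq> A i" for xs
    proof (unfold_locales, goal_cases)
      case (1 a)
      then show ?case using that ends_C by (fastforce simp: C_def dest: cyc_in_set)
    next
      case (2 a)
      then show ?case using that ends_C by (fastforce simp: C_def dest: cyc_in_set)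
    qed
    then have sub: "subgraph (C (X i)) F" "subgraph (C (Y i)) F"
      using wf_F sub_A set [OF i]
      by (auto simp: subgraph_def compatible_def) (auto simp: C_def F_def)
    have "spanning F D"
      using wf_F wf_digraph A [OF i] e
      by (auto simp: spanning_def subgraph_def compatible_def F_def)
    moreover have "disjoint_family_on (\<lambda>j. verts ([C (X i), C (Y i)] ! j)) {..<length [C (X i), C (Y i)]}"
      using dist [OF i] by (simp add: disjoint_family_on_def C_def lessThan_Suc Int_commute)
    moreover have "verts F = (\<Union>C \<in> set [C (X i), C (Y i)]. verts C)"
      "arcs F = (\<Union>C \<in> set [C (X i), C (Y i)]. arcs C)"
      using set [OF i] by (auto simp: F_def C_def A_def)
    ultimately have "directed_cycle_factor [2, n - 2] D F"
      unfolding directed_cycle_factor_def using cycles sub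
      by (intro conjI exI [of _ "[C (X i), C (Y i)]"]) auto
    then show ?thesis by (auto simp: F_def)
  qed
  ultimately show ?thesis
    unfolding has_directed_cycle_factorization_def
    by (intro exI [of _ "(\<lambda>i. e ` A i) ` {..<n - 1}"]) auto
qed

end
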